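(* The Roman Domination problem is linear-time solvable on the graph class $\mathcal{F}$; that is, there is an algorithm which, given a graph $H \in \mathcal{F}$, computes $\gamma_R(H)$ in time linear in the size of $H$.
   Context: All graphs are finite, simple and undirected. A Roman dominating function of a graph $H=(V,E)$ is a labeling $f:V\to\{0,1,2\}$ such that every vertex $u$ with $f(u)=0$ has a neighbour $v$ with $f(v)=2$; its weight is $\sum_{u\in V}f(u)$, and $\gamma_R(H)$ is the minimum weight of a Roman dominating function of $H$. The Roman Domination problem asks to compute $\gamma_R(H)$. Graph class $\mathcal{F}$: it consists of all graphs $H$ obtained from some 3-regular graph $G=(V,E)$ by the following procedure. Take three copies $G_1=(V_1,E_1)$, $G_2=(V_2,E_2)$, $G_3=(V_3,E_3)$ of the complement $\overline{G}$; the copy of $u\in V(G)$ in $G_i$ is denoted $u_i$. For each $u_1\in V_1$, make $u_1$ adjacent to every vertex in $N_{G_2}(u_2)$ and in $N_{G_3}(u_3)$. For each $u_2\in V_2$, make $u_2$ adjacent to every vertex in $N_{G_3}(u_3)$. Then add three new vertices $v_1,v_2,v_3$ (pairwise non-adjacent), each adjacent to every vertex of $V_1\cup V_2\cup V_3$. *)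

theory Defs
  imports "HOL-Library.FuncSet"
begin

type_synonym 'a graph = "'a set \<times> 'a set set"

abbreviation verts :: "'a graph \<Rightarrow> 'a set" where
  "verts \<equiv> fst"

abbreviation edges :: "'a graph \<Rightarrow> 'a set set" where
  "edges \<equiv> snd"

definition simple_graph :: "'a graph \<Rightarrow> bool" where
  "simple_graph G \<longleftrightarrow> finite (verts G) \<and> (\<forall>e\<in>edges G. e \<subseteq> verts G \<and> card e = 2)"

definition neighbours :: "'a graph \<Rightarrow> 'a \<Rightarrow> 'a set" where
  "neighbours G u = {v. {u, v} \<in> edges G}"

definition regular :: "nat \<Rightarrow> 'a graph \<Rightarrow> bool" where
  "regular d G \<longleftrightarrow> (\<forall>u\<in>verts G. card (neighbours G u) = d)"

definition complement :: "'a graph \<Rightarrow> 'a graph" where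
  "complement G =
     (verts G, {{u, v} | u v. u \<in> verts G \<and> v \<in> verts G \<and> u \<noteq> v \<and> {u, v} \<notin> edges G})"

definition isomorphic :: "'a graph \<Rightarrow> 'b graph \<Rightarrow> bool" where
  "isomorphic G H \<longleftrightarrow>
     (\<exists>\<phi>. bij_betw \<phi> (verts G) (verts H) \<and> edges H = (\<lambda>e. \<phi> ` e) ` edges G)"

text \<open>Only the values of a labeling on the vertices of the graph matter.\<close>

definition roman_dominating :: "'a graph \<Rightarrow> ('a \<Rightarrow> nat) \<Rightarrow> bool" where
  "roman_dominating H f \<longleftrightarrow>
     f \<in> verts H \<rightarrow> {0, 1, 2} \<and>
     (\<forall>u\<in>verts H. f u = 0 \<longrightarrow> (\<exists>v\<in>neighbours H u. f v = 2))"

definition weight :: "'a graph \<Rightarrow> ('a \<Rightarrow> nat) \<Rightarrow> nat" where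
  "weight H f = (\<Sum>u\<in>verts H. f u)"

definition roman_domination_number :: "'a graph \<Rightarrow> nat" where
  "roman_domination_number H = (LEAST w. \<exists>f. roman_dominating H f \<and> weight H f = w)"

text \<open>\<open>Copy i u\<close> is the copy $u_i$ of $u$, and \<open>New k\<close> is the added vertex $v_k$.\<close>

datatype 'a vertex = Copy nat 'a | New nat

definition construction :: "'a graph \<Rightarrow> 'a vertex graph" where
  "construction G =
     ({Copy i u | i u. i \<in> {1, 2, 3} \<and> u \<in> verts G} \<union> {New k | k. k \<in> {1, 2, 3}},
      {{Copy i u, Copy i w} | i u w. i \<in> {1, 2, 3} \<and> {u, w} \<in> edges (complement G)} \<union>
      {{Copy i u, Copy j w} | i j u w. (i, j) \<in> {(1, 2), (1, 3), (2, 3)} \<and>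
         u \<in> verts G \<and> w \<in> neighbours (complement G) u} \<union>
      {{New k, Copy i u} | k i u. k \<in> {1, 2, 3} \<and> i \<in> {1, 2, 3} \<and> u \<in> verts G})"

text \<open>
  The class is closed under isomorphism, so that a member carries no information about
  how it was constructed. Every finite graph has an isomorphic copy with vertices of type
  \<open>nat\<close>, so taking \<open>G\<close> of this type is no restriction.
\<close>

definition class_F :: "nat graph set" where
  "class_F = {H. \<exists>G :: nat graph.
     simple_graph G \<and> regular 3 G \<and> isomorphic (construction G) H}"

text \<open>
  The machine has registers and a random access memory, both holding natural numbers.
  A program is a list of instructions; a program counter beyond its end means that the
  machine has halted. Every instruction takes one unit of time. The first argument of
  the instructions that write a register is the target register; \<open>Load\<close> and
  \<open>Store\<close> take the memory address from their register \<open>a\<close>.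
\<close>

datatype instr =
    Const nat nat
  | Move nat nat
  | Add nat nat nat
  | Sub nat nat nat
  | Load nat nat
  | Store nat nat
  | Jump nat
  | JumpIfZero nat nat

type_synonym program = "instr list"

record state =
  pc :: nat
  reg :: "nat \<Rightarrow> nat"
  mem :: "nat \<Rightarrow> nat"

definition set_reg :: "nat \<Rightarrow> nat \<Rightarrow> state \<Rightarrow> state" where
  "set_reg d x s = s\<lparr>pc := Suc (pc s), reg := (reg s)(d := x)\<rparr>"

fun exec :: "instr \<Rightarrow> state \<Rightarrow> state" where
  "exec (Const d k) s = set_reg d k s"
| "exec (Move d a) s = set_reg d (reg s a) s"
| "exec (Add d a b) s = set_reg d (reg s a + reg s b) s"
| "exec (Sub d a b) s = set_reg d (reg s a - reg s b) s"
| "exec (Load d a) s = set_reg d (mem s (reg s a)) s"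
| "exec (Store a b) s = s\<lparr>pc := Suc (pc s), mem := (mem s)(reg s a := reg s b)\<rparr>"
| "exec (Jump l) s = s\<lparr>pc := l\<rparr>"
| "exec (JumpIfZero a l) s = s\<lparr>pc := (if reg s a = 0 then l else Suc (pc s))\<rparr>"

definition halted :: "program \<Rightarrow> state \<Rightarrow> bool" where
  "halted p s \<longleftrightarrow> length p \<le> pc s"

definition step :: "program \<Rightarrow> state \<Rightarrow> state" where
  "step p s = (if halted p s then s else exec (p ! pc s) s)"

definition initial_state :: "nat list \<Rightarrow> state" where
  "initial_state xs =
     \<lparr>pc = 0, reg = (\<lambda>_. 0), mem = (\<lambda>i. if i < length xs then xs ! i else 0)\<rparr>"

definition run :: "program \<Rightarrow> nat list \<Rightarrow> nat \<Rightarrow> state" where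
  "run p xs t = (step p ^^ t) (initial_state xs)"

text \<open>
  The input graph has vertices \<open>0, \<dots>, n - 1\<close> and is given by its adjacency lists, the
  order within each list being arbitrary. In memory they are preceded by \<open>n\<close>, and each
  list is preceded by its length, so the input takes $1 + n + 2m$ cells.
\<close>

definition adjacency_lists :: "nat graph \<Rightarrow> nat list list \<Rightarrow> bool" where
  "adjacency_lists H adj \<longleftrightarrow>
     verts H = {..<length adj} \<and>
     (\<forall>u<length adj. distinct (adj ! u) \<and> set (adj ! u) = neighbours H u)"

definition encode :: "nat list list \<Rightarrow> nat list" where
  "encode adj = length adj # concat (map (\<lambda>ns. length ns # ns) adj)"

definition graph_size :: "nat graph \<Rightarrow> nat" where
  "graph_size H = card (verts H) + card (edges H)"

text \<open>
  Unit cost per instruction is reasonable only for words of $O(\log N)$ bits, \<open>N\<close> being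
  the size of the graph. Hence all numbers occurring in the computation are required to be
  below $(N + 2)^k$ for a constant \<open>k\<close>. The result is expected in register 0.
\<close>

definition linear_time_solvable_on :: "(nat graph \<Rightarrow> nat) \<Rightarrow> nat graph set \<Rightarrow> bool" where
  "linear_time_solvable_on f C \<longleftrightarrow>
     (\<exists>p c k. \<forall>H\<in>C. \<forall>adj. adjacency_lists H adj \<longrightarrow>
        (\<exists>t \<le> c * (graph_size H + 1).
           halted p (run p (encode adj) t) \<and> reg (run p (encode adj) t) 0 = f H) \<and>
        (\<forall>t i. reg (run p (encode adj) t) i < (graph_size H + 2) ^ k \<and>
               mem (run p (encode adj) t) i < (graph_size H + 2) ^ k))"

end

theory Submission
  imports Defs
begin

text \<open>
  The Roman domination number is almost constant on the class, so a machine that only reads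
  the number of vertices computes it.

  Let \<open>H\<close> be built from \<open>G\<close>. If \<open>G\<close> has no vertices, then \<open>H\<close> consists of three isolated
  vertices, each of which needs a positive label, and the number is 3. Otherwise it is 4. Indeed,
  an added vertex is adjacent to all copies and a copy is adjacent to all added vertices, so
  labeling one of each with 2 dominates \<open>H\<close> (lemma \<open>dominating_pair_weight_4\<close>). On the other
  hand, no vertex \<open>v\<close> is close to dominating \<open>H\<close> alone: an added vertex misses the other two added
  vertices, and a copy of \<open>u\<close> misses the other two copies of \<open>u\<close>. A single label 2 thus leaves at
  least two vertices that need labels of their own, and avoiding the label 2 costs as much as there
  are vertices (lemma \<open>weight_ge_4\<close>).

  Since \<open>H\<close> has \<open>3 * m + 3\<close> vertices when \<open>G\<close> has \<open>m\<close>, the two cases are told apart by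
  comparing the first input cell with 3. This takes a constant number of steps, and the
  polynomial bound on the numbers reduces to the fact that every input cell contains a vertex,
  a degree or the number of vertices.
\<close>

section \<open>Bounds on the Roman domination number\<close>

definition edges_within_verts :: "'a graph \<Rightarrow> bool" where
  "edges_within_verts G \<longleftrightarrow> (\<forall>e\<in>edges G. e \<subseteq> verts G)"

lemma neighbours_sym: "v \<in> neighbours G u \<longleftrightarrow> u \<in> neighbours G v"
  by (simp add: neighbours_def insert_commute)

lemma neighbours_subset_verts:
  "edges_within_verts G \<Longrightarrow> neighbours G u \<subseteq> verts G"
  by (auto simp: edges_within_verts_def neighbours_def)

lemma weight_ge_sum_subset:
  assumes "finite (verts H)" "A \<subseteq> verts H"
  shows "sum f A \<le> weight H f"
  unfolding weight_def using assms by (intro sum_mono2) auto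

lemma weight_ge_card_if_positive:
  assumes "\<forall>u\<in>verts H. f u \<noteq> 0"
  shows "card (verts H) \<le> weight H f"
proof -
  have "(\<Sum>u\<in>verts H. 1) \<le> weight H f"
    unfolding weight_def using assms by (intro sum_mono) (auto simp: Suc_le_eq)
  then show ?thesis by simp
qed

text \<open>
  If \<open>v\<close> has label 2, either two of its non-neighbours have positive labels, or one of them is
  dominated by a second vertex with label 2. Both ways the weight reaches 4.
\<close>

lemma weight_ge_4:
  assumes fin: "finite (verts H)" and large: "4 \<le> card (verts H)"
    and non_nb: "\<And>v. v \<in> verts H \<Longrightarrow> \<exists>x\<in>verts H. \<exists>y\<in>verts H.
      x \<noteq> v \<and> y \<noteq> v \<and> x \<noteq> y \<and> x \<notin> neighbours H v \<and> y \<notin> neighbours H v"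
    and within: "edges_within_verts H" and rd: "roman_dominating H f"
  shows "4 \<le> weight H f"
proof (cases "\<exists>v\<in>verts H. f v = 2")
  case False
  then have "\<forall>u\<in>verts H. f u \<noteq> 0"
    using rd neighbours_subset_verts[OF within] unfolding roman_dominating_def by blast
  then show ?thesis
    using weight_ge_card_if_positive[of H f] large by simp
next
  case True
  then obtain v where v: "v \<in> verts H" "f v = 2" by blast
  obtain x y where xy: "x \<in> verts H" "y \<in> verts H" "x \<noteq> v" "y \<noteq> v" "x \<noteq> y"
    "x \<notin> neighbours H v" "y \<notin> neighbours H v"
    using non_nb[OF v(1)] by blast
  have second: "4 \<le> weight H f"
    if z: "z \<in> verts H" "z \<notin> neighbours H v" "f z = 0" for z
  proof -
    obtain w where w: "w \<in> neighbours H z" "f w = 2"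
      using rd z unfolding roman_dominating_def by blast
    have "w \<noteq> v" using w z neighbours_sym by metis
    moreover have "w \<in> verts H" using w neighbours_subset_verts[OF within] by blast
    ultimately show ?thesis
      using weight_ge_sum_subset[OF fin, of "{v, w}" f] v w by simp
  qed
  show ?thesis
  proof (cases "f x = 0 \<or> f y = 0")
    case True
    then show ?thesis using second xy by blast
  next
    case False
    then show ?thesis
      using weight_ge_sum_subset[OF fin, of "{v, x, y}" f] v xy by simp
  qed
qed

lemma roman_domination_number_eqI:
  assumes "roman_dominating H f" "weight H f \<le> w"
    and "\<And>g. roman_dominating H g \<Longrightarrow> w \<le> weight H g"
  shows "roman_domination_number H = w"
  unfolding roman_domination_number_def
  using assms by (intro Least_equality) (auto intro!: exI[of _ f] antisym)

lemma dominating_pair_weight_4: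
  assumes fin: "finite (verts H)" and ab: "a \<in> verts H" "b \<in> verts H" "a \<noteq> b"
    and dom: "\<And>u. u \<in> verts H \<Longrightarrow> u \<in> {a, b} \<or> a \<in> neighbours H u \<or> b \<in> neighbours H u"
  shows "\<exists>f. roman_dominating H f \<and> weight H f = 4"
proof (intro exI conjI)
  let ?f = "\<lambda>u. if u \<in> {a, b} then 2 else 0 :: nat"
  show "roman_dominating H ?f"
    unfolding roman_dominating_def using dom by (auto split: if_splits)
  have "weight H ?f = sum ?f {a, b}"
    unfolding weight_def using fin ab by (intro sum.mono_neutral_right) auto
  then show "weight H ?f = 4" using ab by simp
qed

lemma roman_domination_number_edgeless:
  assumes "edges H = {}"
  shows "roman_domination_number H = card (verts H)"
proof (rule roman_domination_number_eqI)
  show "roman_dominating H (\<lambda>_. 1)" by (simp add: roman_dominating_def)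
  show "weight H (\<lambda>_. 1) \<le> card (verts H)" by (simp add: weight_def)
  fix g
  assume "roman_dominating H g"
  then have "\<forall>u\<in>verts H. g u \<noteq> 0"
    using assms by (auto simp: roman_dominating_def neighbours_def)
  then show "card (verts H) \<le> weight H g" by (rule weight_ge_card_if_positive)
qed

section \<open>Invariance under isomorphism\<close>

lemma isomorphic_sym:
  assumes "isomorphic G H" "edges_within_verts G"
  shows "isomorphic H G"
proof -
  obtain \<phi> where \<phi>: "bij_betw \<phi> (verts G) (verts H)" "edges H = (\<lambda>e. \<phi> ` e) ` edges G"
    using assms unfolding isomorphic_def by blast
  let ?\<psi> = "inv_into (verts G) \<phi>"
  have "?\<psi> ` \<phi> ` e = e" if "e \<in> edges G" for e
    using that assms(2) \<phi>(1) inv_into_image_cancel[of \<phi> "verts G" e]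
    by (auto simp: edges_within_verts_def bij_betw_def)
  then have "edges G = (\<lambda>e. ?\<psi> ` e) ` edges H"
    by (simp add: \<phi>(2) image_image)
  then show ?thesis
    using bij_betw_inv_into[OF \<phi>(1)] unfolding isomorphic_def by blast
qed

lemma isomorphic_edges_within_verts:
  assumes "isomorphic G H" "edges_within_verts G"
  shows "edges_within_verts H"
  using assms by (fastforce simp: isomorphic_def edges_within_verts_def bij_betw_def)

text \<open>
  A labeling of \<open>H\<close> is pulled back along an isomorphism. The other inclusion between the sets of
  weights is the same statement for the inverse isomorphism.
\<close>

lemma isomorphic_pull_back_roman_dominating:
  assumes "isomorphic G H" and within: "edges_within_verts G" and rd: "roman_dominating H f"
  shows "\<exists>g. roman_dominating G g \<and> weight G g = weight H f"
proof -
  obtain \<phi> where bij: "bij_betw \<phi> (verts G) (verts H)"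
    and edges: "edges H = (\<lambda>e. \<phi> ` e) ` edges G"
    using assms unfolding isomorphic_def by blast
  have inj: "inj_on \<phi> (verts G)" and image: "\<phi> ` verts G = verts H"
    using bij by (auto simp: bij_betw_def)
  have "\<exists>v\<in>neighbours G u. f (\<phi> v) = 2" if u: "u \<in> verts G" "f (\<phi> u) = 0" for u
  proof -
    obtain w where w: "{\<phi> u, w} \<in> edges H" "f w = 2"
      using rd u image unfolding roman_dominating_def neighbours_def by blast
    then obtain e where e: "e \<in> edges G" "{\<phi> u, w} = \<phi> ` e" using edges by blast
    have sub: "e \<subseteq> verts G" using e(1) within by (auto simp: edges_within_verts_def)
    obtain v where v: "v \<in> e" "w = \<phi> v" using e(2) by blast
    have "\<phi> ` {u, v} = \<phi> ` e" using e(2) v by simp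
    then have "{u, v} = e" using inj_on_image_eq_iff[OF inj, of "{u, v}" e] sub v u by auto
    then show ?thesis using e w v by (auto simp: neighbours_def)
  qed
  moreover have "f (\<phi> u) \<in> {0, 1, 2}" if "u \<in> verts G" for u
    using rd image that unfolding roman_dominating_def by blast
  ultimately have "roman_dominating G (f \<circ> \<phi>)"
    unfolding roman_dominating_def by simp
  moreover have "weight G (f \<circ> \<phi>) = weight H f"
    unfolding weight_def using sum.reindex_bij_betw[OF bij, of f] by simp
  ultimately show ?thesis by blast
qed

lemma isomorphic_roman_domination_number:
  assumes iso: "isomorphic G H" and within: "edges_within_verts G"
  shows "roman_domination_number H = roman_domination_number G"
proof -
  have "(\<exists>f. roman_dominating H f \<and> weight H f = w) \<longleftrightarrow>
    (\<exists>f. roman_dominating G f \<and> weight G f = w)" for w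
    using isomorphic_pull_back_roman_dominating[OF iso within]
      isomorphic_pull_back_roman_dominating[OF isomorphic_sym[OF iso within]
        isomorphic_edges_within_verts[OF iso within]]
    by metis
  then show ?thesis by (simp add: roman_domination_number_def)
qed

section \<open>The Roman domination number of the construction\<close>

lemma construction_within_verts: "edges_within_verts (construction G)"
  by (auto simp: edges_within_verts_def construction_def complement_def neighbours_def
      doubleton_eq_iff)

lemma verts_construction:
  "verts (construction G) = (\<lambda>(i, u). Copy i u) ` ({1, 2, 3} \<times> verts G) \<union> New ` {1, 2, 3}"
  by (auto simp: construction_def)

lemma card_verts_construction:
  assumes "finite (verts G)"
  shows "card (verts (construction G)) = 3 * card (verts G) + 3"
proof -
  have "inj_on (\<lambda>(i, u). Copy i u) ({1, 2, 3} \<times> verts G)" by (auto simp: inj_on_def)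
  then have "card ((\<lambda>(i, u). Copy i u) ` ({1, 2, 3} \<times> verts G)) = 3 * card (verts G)"
    by (simp add: card_image card_cartesian_product)
  moreover have "card (New ` {1, 2, 3} :: 'a vertex set) = 3"
    by (subst card_image) (auto simp: inj_on_def)
  ultimately show ?thesis
    unfolding verts_construction using assms by (subst card_Un_disjoint) auto
qed

lemma New_not_adjacent_New: "New l \<notin> neighbours (construction G) (New k)"
  by (auto simp: neighbours_def construction_def doubleton_eq_iff)

lemma Copy_not_adjacent_Copy_same: "Copy j u \<notin> neighbours (construction G) (Copy i u)"
  by (auto simp: neighbours_def construction_def complement_def doubleton_eq_iff)

lemma New_adjacent_Copy:
  assumes "k \<in> {1, 2, 3}" "i \<in> {1, 2, 3}" "u \<in> verts G"
  shows "New k \<in> neighbours (construction G) (Copy i u)"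
    and "Copy i u \<in> neighbours (construction G) (New k)"
proof -
  have "{New k, Copy i u} \<in> edges (construction G)"
    unfolding construction_def snd_conv using assms by blast
  then show "New k \<in> neighbours (construction G) (Copy i u)"
    and "Copy i u \<in> neighbours (construction G) (New k)"
    by (simp_all add: neighbours_def insert_commute)
qed

lemma construction_two_non_neighbours:
  assumes "v \<in> verts (construction G)"
  shows "\<exists>x\<in>verts (construction G). \<exists>y\<in>verts (construction G).
    x \<noteq> v \<and> y \<noteq> v \<and> x \<noteq> y \<and>
    x \<notin> neighbours (construction G) v \<and> y \<notin> neighbours (construction G) v"
proof -
  have others: "\<exists>j\<in>{1, 2, 3}. \<exists>l\<in>{1, 2, 3}. j \<noteq> i \<and> l \<noteq> i \<and> j \<noteq> l"
    if "i \<in> {1, 2, 3}" for i :: nat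
    using that by auto
  show ?thesis
  proof (cases v)
    case (Copy i u)
    then have iu: "i \<in> {1, 2, 3}" "u \<in> verts G" using assms by (auto simp: construction_def)
    obtain j l where jl: "j \<in> {1, 2, 3}" "l \<in> {1, 2, 3}" "j \<noteq> i" "l \<noteq> i" "j \<noteq> l"
      using others[OF iu(1)] by blast
    show ?thesis
    proof (intro bexI conjI)
      show "Copy j u \<in> verts (construction G)" "Copy l u \<in> verts (construction G)"
        using iu jl by (auto simp: construction_def)
    qed (simp_all add: Copy jl(3-5) jl(5)[symmetric] Copy_not_adjacent_Copy_same)
  next
    case (New i)
    then have i: "i \<in> {1, 2, 3}" using assms by (auto simp: construction_def)
    obtain j l where jl: "j \<in> {1, 2, 3}" "l \<in> {1, 2, 3}" "j \<noteq> i" "l \<noteq> i" "j \<noteq> l"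
      using others[OF i] by blast
    show ?thesis
    proof (intro bexI conjI)
      show "New j \<in> verts (construction G)" "New l \<in> verts (construction G)"
        using jl by (auto simp: construction_def)
    qed (simp_all add: New jl(3-5) jl(5)[symmetric] New_not_adjacent_New)
  qed
qed

lemma roman_domination_number_construction:
  assumes fin: "finite (verts G)"
  shows "roman_domination_number (construction G) = (if verts G = {} then 3 else 4)"
proof (cases "verts G = {}")
  case True
  then have "edges (construction G) = {}" by (auto simp: construction_def complement_def)
  then show ?thesis
    using roman_domination_number_edgeless card_verts_construction[OF fin] True by fastforce
next
  case False
  let ?H = "construction G"
  obtain u where u: "u \<in> verts G" using False by blast
  have fin_H: "finite (verts ?H)" using fin by (simp add: verts_construction)
  have "card (verts G) > 0" using fin False by (simp add: card_gt_0_iff)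
  then have large: "4 \<le> card (verts ?H)" using card_verts_construction[OF fin] by simp
  have "\<exists>f. roman_dominating ?H f \<and> weight ?H f = 4"
  proof (rule dominating_pair_weight_4[OF fin_H])
    show "New 1 \<in> verts ?H" "Copy 1 u \<in> verts ?H" "New 1 \<noteq> Copy 1 u"
      using u by (auto simp: construction_def)
    fix x
    assume "x \<in> verts ?H"
    then consider i w where "x = Copy i w" "i \<in> {1, 2, 3}" "w \<in> verts G"
      | k where "x = New k" "k \<in> {1, 2, 3}"
      by (auto simp: verts_construction)
    then show "x \<in> {New 1, Copy 1 u} \<or> New 1 \<in> neighbours ?H x \<or> Copy 1 u \<in> neighbours ?H x"
    proof cases
      case 1
      then show ?thesis using New_adjacent_Copy(1)[of 1 i w G] by simp
    next
      case 2
      then show ?thesis using New_adjacent_Copy(2)[of k 1 u G] u by simp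
    qed
  qed
  then have "roman_domination_number ?H = 4"
    using weight_ge_4[OF fin_H large construction_two_non_neighbours construction_within_verts]
    by (auto intro: roman_domination_number_eqI)
  then show ?thesis using False by simp
qed

lemma class_F_properties:
  assumes "H \<in> class_F"
  shows "edges_within_verts H" and "3 \<le> card (verts H)"
    and "roman_domination_number H = (if card (verts H) = 3 then 3 else 4)"
proof -
  obtain G :: "nat graph" where G: "simple_graph G" and iso: "isomorphic (construction G) H"
    using assms unfolding class_F_def by blast
  have fin: "finite (verts G)" using G by (simp add: simple_graph_def)
  have card: "card (verts H) = 3 * card (verts G) + 3"
    using iso card_verts_construction[OF fin] bij_betw_same_card
    unfolding isomorphic_def by metis
  show "edges_within_verts H"
    using isomorphic_edges_within_verts[OF iso construction_within_verts] .
  show "3 \<le> card (verts H)" using card by simp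
  show "roman_domination_number H = (if card (verts H) = 3 then 3 else 4)"
    using isomorphic_roman_domination_number[OF iso construction_within_verts]
      roman_domination_number_construction[OF fin] card fin by simp
qed

section \<open>The program\<close>

lemma encode_entry_le:
  assumes adj: "adjacency_lists H adj" and within: "edges_within_verts H"
    and x: "x \<in> set (encode adj)"
  shows "x \<le> length adj"
proof -
  have "length ns \<le> length adj \<and> (\<forall>v\<in>set ns. v < length adj)" if "ns \<in> set adj" for ns
  proof -
    obtain u where u: "u < length adj" "ns = adj ! u"
      using \<open>ns \<in> set adj\<close> by (metis in_set_conv_nth)
    have dist: "distinct ns" and sub: "set ns \<subseteq> {..<length adj}"
      using adj u neighbours_subset_verts[OF within, of u] unfolding adjacency_lists_def by auto
    have "length ns \<le> length adj"
      using card_mono[OF _ sub] distinct_card[OF dist] by simp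
    then show ?thesis using sub by auto
  qed
  then show ?thesis using x by (fastforce simp: encode_def)
qed

text \<open>
  The difference of the number of vertices and 3 is truncated to a bit, to which the number 3,
  still in register 1, is added.
\<close>

definition program_F :: program where
  "program_F =
    [Load 0 0, Const 1 3, Sub 0 0 1, JumpIfZero 0 5, Const 0 1, Add 0 0 1]"

lemma run_Suc: "run p xs (Suc t) = step p (run p xs t)"
  by (simp add: run_def)

lemma run_halted:
  assumes "halted p (run p xs t)" "t \<le> t'"
  shows "run p xs t' = run p xs t"
  using assms(2) by (induction rule: dec_induct) (simp_all add: run_Suc step_def assms(1))

text \<open>
  All states are determined, one after the other. When the jump is taken, the machine halts one
  step earlier, and the last state is repeated.
\<close>

lemma run_program_F:
  fixes xs :: "nat list"
  defines "n \<equiv> hd xs" and "r \<equiv> run program_F xs"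
  assumes "xs \<noteq> []"
  shows "halted program_F (r 6)"
    and "reg (r 6) 0 = (if n \<le> 3 then 3 else 4)"
    and "reg (r t) i \<le> max n 4"
    and "mem (r t) = mem (initial_state xs)"
proof -
  define M where "M = mem (initial_state xs)"
  define R where "R = (\<lambda>_::nat. 0::nat)"
  have M0: "M 0 = n"
    using assms(3) by (simp add: M_def n_def initial_state_def hd_conv_nth)
  have r0: "r 0 = \<lparr>pc = 0, reg = R, mem = M\<rparr>"
    by (simp add: r_def run_def initial_state_def M_def R_def)
  have r_Suc: "r (Suc t) = step program_F (r t)" for t
    by (simp add: r_def run_Suc)
  note exec_simps = step_def halted_def program_F_def set_reg_def
  have r1: "r (Suc 0) = \<lparr>pc = 1, reg = R(0 := n), mem = M\<rparr>"
    by (simp add: r_Suc r0 exec_simps R_def M0)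
  have r2: "r (Suc (Suc 0)) = \<lparr>pc = 2, reg = R(0 := n, 1 := 3), mem = M\<rparr>"
    by (simp add: r_Suc[of "Suc 0"] r1 exec_simps)
  have r3: "r (Suc (Suc (Suc 0))) = \<lparr>pc = 3, reg = R(0 := n - 3, 1 := 3), mem = M\<rparr>"
    by (simp add: r_Suc[of "Suc (Suc 0)"] r2 exec_simps fun_upd_twist)
  have r4: "r (Suc (Suc (Suc (Suc 0)))) =
    \<lparr>pc = (if n \<le> 3 then 5 else 4), reg = R(0 := n - 3, 1 := 3), mem = M\<rparr>"
    by (simp add: r_Suc[of "Suc (Suc (Suc 0))"] r3 exec_simps)
  have r5: "r (Suc (Suc (Suc (Suc (Suc 0))))) =
    (if n \<le> 3 then \<lparr>pc = 6, reg = R(0 := 3, 1 := 3), mem = M\<rparr>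
     else \<lparr>pc = 5, reg = R(0 := 1, 1 := 3), mem = M\<rparr>)"
    by (simp add: r_Suc[of "Suc (Suc (Suc (Suc 0)))"] r4 exec_simps fun_upd_twist)
  have r6: "r 6 = \<lparr>pc = 6, reg = R(0 := (if n \<le> 3 then 3 else 4), 1 := 3), mem = M\<rparr>"
    using r_Suc[of "Suc (Suc (Suc (Suc (Suc 0))))"]
    by (simp add: r5 exec_simps fun_upd_twist eval_nat_numeral)
  show halt: "halted program_F (r 6)" by (simp add: r6 halted_def program_F_def)
  show "reg (r 6) 0 = (if n \<le> 3 then 3 else 4)" by (simp add: r6)
  have "t \<in> {0, Suc 0, Suc (Suc 0), Suc (Suc (Suc 0)), Suc (Suc (Suc (Suc 0))),
      Suc (Suc (Suc (Suc (Suc 0))))} \<or> 6 \<le> t"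
    by auto
  moreover have "r t = r 6" if "6 \<le> t"
    using run_halted halt that unfolding r_def by blast
  ultimately have "reg (r t) i \<le> max n 4 \<and> mem (r t) = M"
    by (elim disjE insertE) (auto simp: r0 r1 r2 r3 r4 r5 r6 R_def)
  then show "reg (r t) i \<le> max n 4" "mem (r t) = mem (initial_state xs)"
    by (simp_all add: M_def)
qed

theorem theorem3p1: "linear_time_solvable_on roman_domination_number class_F"
  unfolding linear_time_solvable_on_def
proof (intro exI ballI allI impI)
  fix H adj
  assume H: "H \<in> class_F" and adj: "adjacency_lists H adj"
  let ?r = "run program_F (encode adj)"
  let ?N = "graph_size H"
  have n: "card (verts H) = length adj" using adj by (simp add: adjacency_lists_def)
  have hd: "encode adj \<noteq> []" "hd (encode adj) = length adj" by (simp_all add: encode_def)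
  have N: "length adj \<le> ?N" "3 \<le> ?N" "3 \<le> length adj"
    using class_F_properties(2)[OF H] n by (simp_all add: graph_size_def)
  have "reg (?r 6) 0 = roman_domination_number H"
    using run_program_F(2)[OF hd(1)] class_F_properties(3)[OF H] n N hd(2) by auto
  then have "\<exists>t \<le> 6 * (?N + 1). halted program_F (?r t) \<and> reg (?r t) 0 = roman_domination_number H"
    using run_program_F(1)[OF hd(1)] by (intro exI[of _ 6]) simp
  moreover have "reg (?r t) i < (?N + 2) ^ 1" for t i
    using run_program_F(3)[OF hd(1), of t i] hd(2) N by simp
  moreover have "mem (?r t) i < (?N + 2) ^ 1" for t i
  proof (cases "i < length (encode adj)")
    case True
    then have "encode adj ! i \<le> length adj"
      using encode_entry_le[OF adj class_F_properties(1)[OF H]] by simp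
    then show ?thesis
      using True run_program_F(4)[OF hd(1), of t] N by (simp add: initial_state_def)
  next
    case False
    then show ?thesis
      using run_program_F(4)[OF hd(1), of t] by (simp add: initial_state_def)
  qed
  ultimately show "(\<exists>t \<le> 6 * (?N + 1).
      halted program_F (?r t) \<and> reg (?r t) 0 = roman_domination_number H) \<and>
    (\<forall>t i. reg (?r t) i < (?N + 2) ^ 1 \<and> mem (?r t) i < (?N + 2) ^ 1)"
    by blast
qed

end
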